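(* For every $n\ge 5$, the underlying graph $J_n^*(1)$ of the finite Jaco graph $J_n(1)$ has at least one identity curling subsequence, and all identity curling subsequences of $J_n^*(1)$ have cardinality $3$.
   Context: The Jaco graph of order $1$, $J_\infty(1)$, is the directed graph with vertex set $\{v_i: i\in\mathbb{N}\}$ ($\mathbb{N}=\{1,2,\dots\}$) and arc set contained in $\{(v_i,v_j): i,j\in\mathbb{N},\ i<j\}$, where, for $i<j$, $(v_i,v_j)$ is an arc if and only if $2i-d^-(v_i)\ge j$; here $d^-(v_i)$ is the in-degree of $v_i$. The finite Jaco graph $J_n(1)$ is obtained from $J_\infty(1)$ by deleting all vertices $v_t$ with $t>n$ (and their arcs), and $J_n^*(1)$ is its underlying undirected graph. For a finite non-empty string $S$ of non-negative integers, $cn(S)$ is the largest $k$ such that $S=X\circ Y^k$, with $\circ$ concatenation, $X$ a possibly empty prefix and $Y$ a non-empty string. The curling number $cn(G)$ of a graph $G$ is the maximum of $cn(S_0)$ over all re-arrangements $S_0$ of its degree sequence. An identity subsequence is a maximal degree subsequence (after re-arrangement) with all entries equal; it is an identity curling subsequence if its curling number (i.e. its length) equals $cn(G)$. *)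

theory Defs
  imports
    "Graph_Theory.Graph_Theory"
    "HOL-Library.Sublist"
    "HOL-Combinatorics.Multiset_Permutations"
begin

text \<open>
  The vertex \<open>v\<^sub>i\<close> is the number \<open>i \<ge> 1\<close>. The arc condition refers to in-degrees of the very
  graph being defined; it determines the graph uniquely because all arcs go upwards
  (\<open>ex1_infinite_jaco_graph\<close> below). The difference is taken in the integers, as
  subtraction on natural numbers truncates.
\<close>

definition is_infinite_jaco_graph :: "nat pair_pre_digraph \<Rightarrow> bool" where
  "is_infinite_jaco_graph G \<longleftrightarrow>
     pverts G = {1..} \<and>
     parcs G \<subseteq> {(i, j). 1 \<le> i \<and> i < j} \<and>
     (\<forall>i j. 1 \<le> i \<and> i < j \<longrightarrow>
        ((i, j) \<in> parcs G \<longleftrightarrow> 2 * int i - int (in_degree (with_proj G) i) \<ge> int j))"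

definition infinite_jaco_graph :: "nat pair_pre_digraph" where
  "infinite_jaco_graph = (THE G. is_infinite_jaco_graph G)"

definition finite_jaco_graph :: "nat \<Rightarrow> (nat, nat \<times> nat) pre_digraph" where
  "finite_jaco_graph n = with_proj infinite_jaco_graph \<restriction> {1..n}"

text \<open>
  An undirected graph is represented as a symmetric digraph, so the degree of a vertex
  is its out-degree there.
\<close>

definition underlying_jaco_graph :: "nat \<Rightarrow> nat pair_pre_digraph" where
  "underlying_jaco_graph n = mk_symmetric (finite_jaco_graph n)"

definition degree_multiset :: "'a pair_pre_digraph \<Rightarrow> nat multiset" where
  "degree_multiset G = image_mset (out_degree (with_proj G)) (mset_set (pverts G))"

definition degree_sequences :: "'a pair_pre_digraph \<Rightarrow> nat list set" where
  "degree_sequences G = permutations_of_multiset (degree_multiset G)"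

definition curling_number :: "'a list \<Rightarrow> nat" where
  "curling_number S = Max {k. \<exists>X Y. Y \<noteq> [] \<and> S = X @ concat (replicate k Y)}"

definition graph_curling_number :: "'a pair_pre_digraph \<Rightarrow> nat" where
  "graph_curling_number G = Max (curling_number ` degree_sequences G)"

definition constant_degree_subsequence :: "'a pair_pre_digraph \<Rightarrow> nat list \<Rightarrow> bool" where
  "constant_degree_subsequence G I \<longleftrightarrow>
     (\<exists>S \<in> degree_sequences G. subseq I S) \<and> (\<exists>d. set I = {d})"

definition identity_subsequence :: "'a pair_pre_digraph \<Rightarrow> nat list \<Rightarrow> bool" where
  "identity_subsequence G I \<longleftrightarrow>
     constant_degree_subsequence G I \<and>
     (\<forall>J. constant_degree_subsequence G J \<and> subseq I J \<longrightarrow> J = I)"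

definition identity_curling_subsequence :: "'a pair_pre_digraph \<Rightarrow> nat list \<Rightarrow> bool" where
  "identity_curling_subsequence G I \<longleftrightarrow>
     identity_subsequence G I \<and> curling_number I = graph_curling_number G"

lemma length_concat_replicate: "length (concat (replicate k Y)) = k * length Y"
  by (induction k) auto

lemma finite_curling_exponents:
  "finite {k. \<exists>X Y. Y \<noteq> [] \<and> S = X @ concat (replicate k Y)}"
proof (rule finite_subset)
  show "{k. \<exists>X Y. Y \<noteq> [] \<and> S = X @ concat (replicate k Y)} \<subseteq> {..length S}"
    by (auto simp: length_concat_replicate Suc_le_eq intro!: trans_le_add2)
qed simp

lemma in_degree_infinite_jaco_graph:
  assumes "is_infinite_jaco_graph G"
  shows "in_degree (with_proj G) j =
           card {i \<in> {1..<j}. j + in_degree (with_proj G) i \<le> 2 * i}"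
proof -
  let ?A = "{i \<in> {1..<j}. j + in_degree (with_proj G) i \<le> 2 * i}"
  have arc_iff: "(i, j) \<in> parcs G \<longleftrightarrow> i \<in> ?A" for i
    using assms unfolding is_infinite_jaco_graph_def by force
  have "in_arcs (with_proj G) j = (\<lambda>i. (i, j)) ` ?A"
    unfolding in_arcs_def using arc_iff by force
  then show ?thesis
    unfolding in_degree_def by (simp add: card_image inj_on_def)
qed

function jaco_in_degree :: "nat \<Rightarrow> nat" where
  "jaco_in_degree j = (\<Sum>i\<in>{1..<j}. if j + jaco_in_degree i \<le> 2 * i then 1 else 0)"
  by auto
termination by (relation "measure id") auto

declare jaco_in_degree.simps [simp del]

lemma jaco_in_degree_eq:
  "jaco_in_degree j = card {i \<in> {1..<j}. j + jaco_in_degree i \<le> 2 * i}"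
  by (subst jaco_in_degree.simps) (simp add: sum.If_cases Int_def)

lemma in_degree_eq_jaco_in_degree:
  assumes "is_infinite_jaco_graph G"
  shows "in_degree (with_proj G) j = jaco_in_degree j"
proof (induction j rule: less_induct)
  case (less j)
  have "{i \<in> {1..<j}. j + in_degree (with_proj G) i \<le> 2 * i} =
        {i \<in> {1..<j}. j + jaco_in_degree i \<le> 2 * i}"
    using less by auto
  then show ?case
    using in_degree_infinite_jaco_graph[OF assms, of j] jaco_in_degree_eq[of j] by simp
qed

lemma ex1_infinite_jaco_graph: "\<exists>!G. is_infinite_jaco_graph G"
proof (rule ex1I)
  define P where "P = {(i, j). 1 \<le> i \<and> i < j \<and> j + jaco_in_degree i \<le> 2 * i}"
  let ?G = "\<lparr>pverts = {1..}, parcs = P\<rparr>"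
  have "in_degree (with_proj ?G) j = jaco_in_degree j" for j
  proof -
    have "in_arcs (with_proj ?G) j =
          (\<lambda>i. (i, j)) ` {i \<in> {1..<j}. j + jaco_in_degree i \<le> 2 * i}"
      unfolding in_arcs_def P_def by auto
    then show ?thesis
      unfolding in_degree_def jaco_in_degree_eq[of j] by (simp add: card_image inj_on_def)
  qed
  then show "is_infinite_jaco_graph ?G"
    unfolding is_infinite_jaco_graph_def by (auto simp: P_def)
  fix G assume G: "is_infinite_jaco_graph G"
  have "(i, j) \<in> parcs G \<longleftrightarrow> (i, j) \<in> P" for i j
  proof (cases "1 \<le> i \<and> i < j")
    case True
    then have "(i, j) \<in> parcs G \<longleftrightarrow> 2 * int i - int (jaco_in_degree i) \<ge> int j"
      using G in_degree_eq_jaco_in_degree[OF G, of i]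
      unfolding is_infinite_jaco_graph_def by simp
    then show ?thesis
      using True unfolding P_def by auto
  next
    case False
    then show ?thesis
      using G unfolding is_infinite_jaco_graph_def P_def by auto
  qed
  then have "parcs G = P" by auto
  moreover have "pverts G = {1..}"
    using G by (simp add: is_infinite_jaco_graph_def)
  ultimately show "G = ?G" by simp
qed

lemma is_infinite_jaco_graph: "is_infinite_jaco_graph infinite_jaco_graph"
  unfolding infinite_jaco_graph_def by (rule theI'[OF ex1_infinite_jaco_graph])

end

theory Submission
  imports Defs
begin

text \<open>
  The curling number of a graph is the largest multiplicity in its degree multiset: a repeated
  block \<open>Y\<close> contributes its first entry once per repetition, so the exponent never exceeds a
  multiplicity, and listing all copies of the most frequent degree last attains it. Since the
  curling number of a constant string is its length, both claims reduce to: the largest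
  multiplicity of a degree in \<open>J\<^sub>n\<^sup>*(1)\<close> is \<open>3\<close>.

  Let \<open>d(i) = i - d\<^sup>-(v\<^sub>i)\<close>, which is the out-degree of \<open>v\<^sub>i\<close> in the infinite graph, and let
  \<open>f(i) = i + d(i)\<close>, the index of its last out-neighbour. Counting the non-predecessors
  of \<open>v\<^sub>j\<close> gives \<open>d(j) = 1 + #{i | f(i) < j}\<close>, so \<open>d\<close> is monotone, \<open>f\<close> is strictly monotone,
  and \<open>d\<close> increases (by one) from \<open>j\<close> to \<open>j + 1\<close> exactly if \<open>j\<close> is a value of \<open>f\<close>. Hence
  \<open>f\<close> grows by one or two, its values miss no two consecutive numbers, and so \<open>d\<close> takes each
  value at most twice (\<open>jaco_out_degree_less\<close>). Three consecutive increases of \<open>d\<close> would need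
  three consecutive numbers among the values of \<open>f\<close>, hence three arguments with the same \<open>d\<close>;
  this is impossible, so among four consecutive arguments \<open>d\<close> repeats a value (\<open>jaco_out_degree_repeats\<close>).

  In \<open>J\<^sub>n\<^sup>*(1)\<close> a vertex with \<open>f(i) \<le> n\<close> keeps all its neighbours and has degree \<open>i\<close>; every
  other vertex is joined to all later ones and has degree \<open>n - d(i)\<close>. A number is therefore the
  degree of at most one vertex of the first kind and at most two of the second. Conversely, for
  \<open>n \<ge> 5\<close> some \<open>v\<^sub>k\<close> and \<open>v\<^bsub>k+1\<^esub>\<close> near the end are of the second kind with
  \<open>d(k) = d(k + 1)\<close>, and \<open>n - d(k)\<close> is the index of a vertex of the first kind, which
  shares their degree.
\<close>

section \<open>Out-degrees in the infinite Jaco graph\<close>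

definition jaco_out_degree :: "nat \<Rightarrow> nat" where
  "jaco_out_degree i = i - jaco_in_degree i"

text \<open>
  The rank \<open>2i - d\<^sup>-(v\<^sub>i)\<close> that bounds the heads of the arcs leaving \<open>v\<^sub>i\<close>, for \<open>i \<ge> 1\<close>.
\<close>

definition jaco_last_neighbour :: "nat \<Rightarrow> nat" where
  "jaco_last_neighbour i = i + jaco_out_degree i"

lemma jaco_in_degree_less:
  assumes "1 \<le> j"
  shows "jaco_in_degree j < j"
proof -
  have "jaco_in_degree j \<le> card {1..<j}"
    unfolding jaco_in_degree_eq[of j] by (rule card_mono) auto
  then show ?thesis using assms by simp
qed

lemma arc_condition_iff:
  assumes "1 \<le> i"
  shows "j + jaco_in_degree i \<le> 2 * i \<longleftrightarrow> j \<le> jaco_last_neighbour i"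
  using jaco_in_degree_less[OF assms]
  unfolding jaco_last_neighbour_def jaco_out_degree_def by linarith

lemma less_jaco_last_neighbour: "1 \<le> i \<Longrightarrow> i < jaco_last_neighbour i"
  using jaco_in_degree_less[of i]
  unfolding jaco_last_neighbour_def jaco_out_degree_def by linarith

lemma jaco_in_degree_eq_card_last_neighbour:
  "jaco_in_degree j = card {i \<in> {1..<j}. j \<le> jaco_last_neighbour i}"
  unfolding jaco_in_degree_eq[of j]
  by (intro arg_cong[where f = card] Collect_cong conj_cong refl)
    (simp add: arc_condition_iff)

text \<open>
  The vertices before \<open>v\<^sub>j\<close> are its predecessors, \<open>d\<^sup>-(v\<^sub>j)\<close> many, and those whose last neighbour
  comes before \<open>v\<^sub>j\<close>. This form of the recursion makes the growth of out-degrees visible.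
\<close>

lemma jaco_out_degree_eq:
  assumes "1 \<le> j"
  shows "jaco_out_degree j = Suc (card {i \<in> {1..<j}. jaco_last_neighbour i < j})"
proof -
  have "card {1..<j} = card {i \<in> {1..<j}. j \<le> jaco_last_neighbour i}
      + card {i \<in> {1..<j}. jaco_last_neighbour i < j}"
  proof -
    have split: "{i \<in> {1..<j}. j \<le> jaco_last_neighbour i}
        \<union> {i \<in> {1..<j}. jaco_last_neighbour i < j} = {1..<j}"
      by auto
    have "card ({i \<in> {1..<j}. j \<le> jaco_last_neighbour i}
        \<union> {i \<in> {1..<j}. jaco_last_neighbour i < j}) = card {i \<in> {1..<j}. j \<le> jaco_last_neighbour i}
        + card {i \<in> {1..<j}. jaco_last_neighbour i < j}"
      by (rule card_Un_disjoint) auto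
    then show ?thesis unfolding split .
  qed
  then show ?thesis
    using assms jaco_in_degree_eq_card_last_neighbour[of j]
    unfolding jaco_out_degree_def by simp
qed

lemma jaco_out_degree_mono:
  assumes "1 \<le> i" "i \<le> j"
  shows "jaco_out_degree i \<le> jaco_out_degree j"
  using assms by (auto simp: jaco_out_degree_eq intro!: card_mono)

lemma jaco_last_neighbour_strict_mono: "strict_mono_on {1..} jaco_last_neighbour"
  by (rule strict_mono_onI)
    (simp add: jaco_last_neighbour_def add_less_le_mono jaco_out_degree_mono)

text \<open>
  Passing from \<open>j\<close> to \<open>j + 1\<close> adds to the counted set the vertices with last neighbour \<open>v\<^sub>j\<close>; by
  injectivity there is at most one.
\<close>

lemma jaco_out_degree_Suc:
  assumes "1 \<le> j"
  shows "jaco_out_degree (Suc j) =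
    jaco_out_degree j + (if j \<in> jaco_last_neighbour ` {1..} then 1 else 0)"
proof -
  let ?A = "{i \<in> {1..<j}. jaco_last_neighbour i < j}"
  let ?B = "{i \<in> {1..}. jaco_last_neighbour i = j}"
  have split: "{i \<in> {1..<Suc j}. jaco_last_neighbour i < Suc j} = ?A \<union> ?B"
    using less_jaco_last_neighbour by (force simp: less_Suc_eq)
  have "card (?A \<union> ?B) = card ?A + card ?B"
  proof (rule card_Un_disjoint)
    show "finite ?B"
      by (rule finite_subset[of _ "{..j}"]) (auto simp: less_jaco_last_neighbour less_imp_le)
  qed auto
  moreover have "card ?B = (if j \<in> jaco_last_neighbour ` {1..} then 1 else 0)"
  proof (cases "j \<in> jaco_last_neighbour ` {1..}")
    case True
    then obtain i where "1 \<le> i" "jaco_last_neighbour i = j" by auto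
    then have "?B = {i}"
      using strict_mono_on_imp_inj_on[OF jaco_last_neighbour_strict_mono]
      by (auto dest: inj_onD)
    with True show ?thesis by simp
  next
    case False
    then have "?B = {}" by auto
    with False show ?thesis by (simp only: card.empty if_False)
  qed
  moreover have "jaco_out_degree (Suc j) = Suc (card (?A \<union> ?B))"
    using jaco_out_degree_eq[of "Suc j"] unfolding split by simp
  ultimately show ?thesis
    using jaco_out_degree_eq[OF assms] by simp
qed

text \<open>
  The last neighbours start at \<open>v\<^sub>2\<close> and, as out-degrees grow by at most one, advance by at most
  two; so they skip no two consecutive vertices.
\<close>

lemma jaco_last_neighbour_gap:
  assumes "1 \<le> j"
  shows "\<exists>i\<ge>1. jaco_last_neighbour i = j \<or> jaco_last_neighbour i = Suc j"
  using assms
proof (induction j rule: nat_induct_at_least)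
  case base
  have "jaco_last_neighbour 1 = Suc 1"
    by (simp add: jaco_last_neighbour_def jaco_out_degree_eq)
  then show ?case by auto
next
  case (Suc j)
  then obtain i where i: "1 \<le> i" "jaco_last_neighbour i = j \<or> jaco_last_neighbour i = Suc j"
    by blast
  have "jaco_last_neighbour (Suc i) = jaco_last_neighbour i + 1 \<or>
      jaco_last_neighbour (Suc i) = jaco_last_neighbour i + 2"
    using jaco_out_degree_Suc[OF i(1)] by (auto simp: jaco_last_neighbour_def)
  moreover have "1 \<le> Suc i" by simp
  ultimately show ?case
    using i by (metis Suc_eq_plus1 add_2_eq_Suc')
qed

text \<open>
  One of \<open>i\<close> and \<open>i + 1\<close> is a last neighbour, so the out-degree grows in one of the next two
  steps. This limits each value of the out-degree to two vertices.
\<close>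

lemma jaco_out_degree_less:
  assumes "1 \<le> i" "Suc i < j"
  shows "jaco_out_degree i < jaco_out_degree j"
proof -
  have "jaco_out_degree i < jaco_out_degree (Suc (Suc i))"
    using assms(1) jaco_last_neighbour_gap[OF assms(1)]
    by (auto simp: jaco_out_degree_Suc image_iff Bex_def)
  also have "\<dots> \<le> jaco_out_degree j"
    using assms by (intro jaco_out_degree_mono) auto
  finally show ?thesis .
qed

text \<open>
  Without a repetition \<open>j\<close>, \<open>j + 1\<close> and \<open>j + 2\<close> are the last neighbours of some \<open>a < b < c\<close>. But
  then \<open>c - a \<ge> 2\<close>, so the out-degree also grows between \<open>a\<close> and \<open>c\<close>, and the last neighbours of
  these two are at least three apart.
\<close>

lemma jaco_out_degree_repeats:
  assumes "1 \<le> j"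
  shows "\<exists>k\<in>{j, j + 1, j + 2}. jaco_out_degree (Suc k) = jaco_out_degree k"
proof (rule ccontr)
  assume no_repeat: "\<not> ?thesis"
  have "k \<in> jaco_last_neighbour ` {1..}" if "k \<in> {j, j + 1, j + 2}" for k
  proof -
    have "1 \<le> k" using that assms by auto
    then show ?thesis
      using that no_repeat jaco_out_degree_Suc[of k] by (auto split: if_splits)
  qed
  from this[of j] this[of "j + 1"] this[of "j + 2"]
  obtain a b c where abc: "1 \<le> a" "1 \<le> b" "1 \<le> c"
    "jaco_last_neighbour a = j" "jaco_last_neighbour b = j + 1" "jaco_last_neighbour c = j + 2"
    by (auto simp: image_iff)
  then have "a < b" "b < c"
    using strict_mono_on_less[OF jaco_last_neighbour_strict_mono, of a b]
      strict_mono_on_less[OF jaco_last_neighbour_strict_mono, of b c] by auto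
  moreover from this have "jaco_out_degree a < jaco_out_degree c"
    using abc by (intro jaco_out_degree_less) auto
  ultimately show False
    using abc by (simp add: jaco_last_neighbour_def)
qed

section \<open>Degrees in the finite Jaco graph\<close>

lemma arc_infinite_jaco_graph_iff:
  "(i, j) \<in> parcs infinite_jaco_graph \<longleftrightarrow> 1 \<le> i \<and> i < j \<and> j \<le> jaco_last_neighbour i"
  using is_infinite_jaco_graph in_degree_eq_jaco_in_degree[OF is_infinite_jaco_graph, of i]
    arc_condition_iff[of i j]
  unfolding is_infinite_jaco_graph_def by auto

lemma pverts_underlying_jaco_graph: "pverts (underlying_jaco_graph n) = {1..n}"
  by (simp add: underlying_jaco_graph_def finite_jaco_graph_def mk_symmetric_def)

lemma arc_underlying_jaco_graph_iff:
  "(i, j) \<in> parcs (underlying_jaco_graph n) \<longleftrightarrow> i \<in> {1..n} \<and> j \<in> {1..n} \<and>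
     ((i, j) \<in> parcs infinite_jaco_graph \<or> (j, i) \<in> parcs infinite_jaco_graph)"
  unfolding underlying_jaco_graph_def finite_jaco_graph_def parcs_mk_symmetric by auto

text \<open>
  A vertex whose last neighbour survives the truncation has \<open>d(i)\<close> neighbours above and \<open>i - d(i)\<close>
  below, together \<open>i\<close>. Otherwise all of the \<open>n - i\<close> vertices above are neighbours.
\<close>

lemma out_degree_underlying_jaco_graph:
  assumes "i \<in> {1..n}"
  shows "out_degree (with_proj (underlying_jaco_graph n)) i =
    (if jaco_last_neighbour i \<le> n then i else n - jaco_out_degree i)"
proof -
  let ?up = "{i<..min n (jaco_last_neighbour i)}"
  let ?down = "{j \<in> {1..<i}. i \<le> jaco_last_neighbour j}"
  have "out_arcs (with_proj (underlying_jaco_graph n)) i = Pair i ` (?up \<union> ?down)"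
    using assms
    by (auto simp: out_arcs_def arc_underlying_jaco_graph_iff arc_infinite_jaco_graph_iff)
  then have "out_degree (with_proj (underlying_jaco_graph n)) i = card (?up \<union> ?down)"
    unfolding out_degree_def by (simp add: card_image inj_on_def)
  also have "\<dots> = card ?up + card ?down"
    by (rule card_Un_disjoint) auto
  also have "\<dots> = (min n (jaco_last_neighbour i) - i) + jaco_in_degree i"
    by (simp add: jaco_in_degree_eq_card_last_neighbour[of i])
  also have "\<dots> = (if jaco_last_neighbour i \<le> n then i else n - jaco_out_degree i)"
    using assms jaco_in_degree_less[of i]
    by (auto simp: jaco_last_neighbour_def jaco_out_degree_def)
  finally show ?thesis .
qed

lemma count_degree_multiset:
  assumes "finite (pverts G)"
  shows "count (degree_multiset G) v = card {i \<in> pverts G. out_degree (with_proj G) i = v}"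
  using assms by (simp add: degree_multiset_def count_image_mset' eq_commute[of v])

lemma count_degree_multiset_jaco:
  "count (degree_multiset (underlying_jaco_graph n)) v =
    card {i \<in> {1..n}. (if jaco_last_neighbour i \<le> n then i else n - jaco_out_degree i) = v}"
proof -
  have "{i \<in> {1..n}. out_degree (with_proj (underlying_jaco_graph n)) i = v} =
    {i \<in> {1..n}. (if jaco_last_neighbour i \<le> n then i else n - jaco_out_degree i) = v}"
    using out_degree_underlying_jaco_graph by (intro Collect_cong) auto
  then show ?thesis
    by (simp add: count_degree_multiset pverts_underlying_jaco_graph)
qed

text \<open>
  Among the vertices that keep all their neighbours only the one with index \<open>v\<close> can
  have degree \<open>v\<close>. The others of
  degree \<open>v\<close>, collected in \<open>?sat\<close>, share the out-degree \<open>n - v\<close>, so there are at most two of them.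
\<close>

lemma count_degree_jaco_le_3:
  "count (degree_multiset (underlying_jaco_graph n)) v \<le> 3"
proof -
  let ?sat = "{i \<in> {1..n}. n < jaco_last_neighbour i \<and> n - jaco_out_degree i = v}"
  have "card ?sat \<le> 2"
  proof (cases "?sat = {}")
    case False
    define k where "k = Min ?sat"
    have k: "k \<in> ?sat"
      unfolding k_def using False by (intro Min_in) auto
    have "?sat \<subseteq> {k, Suc k}"
    proof
      fix i assume i: "i \<in> ?sat"
      then have "k \<le> i" unfolding k_def by (intro Min_le) auto
      have le: "jaco_out_degree x \<le> x" for x by (simp add: jaco_out_degree_def)
      have "jaco_out_degree i = jaco_out_degree k"
        using i k le[of i] le[of k] by auto
      then show "i \<in> {k, Suc k}"
        using jaco_out_degree_less[of k i] \<open>k \<le> i\<close> k by force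
    qed
    then have "card ?sat \<le> card {k, Suc k}" by (intro card_mono) auto
    then show ?thesis by simp
  qed (simp only: card.empty)
  moreover have "card ({v} \<union> ?sat) \<le> card {v} + card ?sat" by (rule card_Un_le)
  moreover have "card {i \<in> {1..n}. (if jaco_last_neighbour i \<le> n then i else n - jaco_out_degree i) = v}
      \<le> card ({v} \<union> ?sat)"
    by (intro card_mono) (auto split: if_splits)
  ultimately show ?thesis
    unfolding count_degree_multiset_jaco by simp
qed

lemma jaco_out_degree_small:
  "jaco_out_degree 4 = 3" "jaco_out_degree 5 = 3" "jaco_out_degree 6 = 4" "jaco_out_degree 7 = 4"
  unfolding jaco_out_degree_def by code_simp+

text \<open>
  Some \<open>k\<close> from \<open>n - 3\<close> to \<open>n - 1\<close> repeats its out-degree. If \<open>n \<ge> 9\<close>, then \<open>k \<ge> 6\<close> and that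
  out-degree is at least \<open>4\<close>, enough for \<open>k + d(k)\<close> to pass \<open>n\<close>. For smaller \<open>n\<close> the pairs
  \<open>4, 5\<close> and \<open>6, 7\<close> serve.
\<close>

lemma ex_saturated_repeat:
  assumes "5 \<le> n"
  shows "\<exists>k. 1 \<le> k \<and> k < n \<and> n < jaco_last_neighbour k \<and>
    jaco_out_degree (Suc k) = jaco_out_degree k"
proof -
  consider "n = 5 \<or> n = 6" | "n = 7 \<or> n = 8" | "9 \<le> n" using assms by linarith
  then show ?thesis
  proof cases
    case 1
    then show ?thesis
      by (intro exI[of _ 4]) (auto simp: jaco_last_neighbour_def jaco_out_degree_small)
  next
    case 2
    then show ?thesis
      by (intro exI[of _ 6]) (auto simp: jaco_last_neighbour_def jaco_out_degree_small)
  next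
    case 3
    then obtain k where k: "k \<in> {n - 3, n - 3 + 1, n - 3 + 2}"
      "jaco_out_degree (Suc k) = jaco_out_degree k"
      using jaco_out_degree_repeats[of "n - 3"] by force
    have "n - 3 \<le> k" "6 \<le> k" "k < n" using k(1) 3 by auto
    then show ?thesis
      using k(2) jaco_out_degree_mono[of 6 k]
      by (intro exI[of _ k]) (auto simp: jaco_last_neighbour_def jaco_out_degree_small)
  qed
qed

lemma ex_count_degree_jaco_eq_3:
  assumes "5 \<le> n"
  shows "\<exists>v. count (degree_multiset (underlying_jaco_graph n)) v = 3"
proof -
  obtain k where k: "1 \<le> k" "k < n" "n < jaco_last_neighbour k"
    "jaco_out_degree (Suc k) = jaco_out_degree k"
    using ex_saturated_repeat[OF assms] by blast
  \<comment> \<open>The common degree of \<open>k\<close> and \<open>k + 1\<close>; read as a vertex it precedes \<open>k\<close>, hence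
    \<open>v + d(v) \<le> v + d(k) = n\<close>, and so it has degree \<open>v\<close> as well.\<close>
  define v where "v = n - jaco_out_degree k"
  have "jaco_out_degree k \<le> k" by (simp add: jaco_out_degree_def)
  then have v: "1 \<le> v" "v \<le> n" "v < k" "v + jaco_out_degree k = n"
    using k by (auto simp: v_def jaco_last_neighbour_def)
  then have "jaco_last_neighbour v \<le> n"
    using jaco_out_degree_mono[of v k] by (simp add: jaco_last_neighbour_def)
  then have "{v, k, Suc k} \<subseteq>
      {i \<in> {1..n}. (if jaco_last_neighbour i \<le> n then i else n - jaco_out_degree i) = v}"
    using k v by (auto simp: jaco_last_neighbour_def)
  then have "card {v, k, Suc k} \<le> count (degree_multiset (underlying_jaco_graph n)) v"
    unfolding count_degree_multiset_jaco by (intro card_mono) auto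
  with v have "3 \<le> count (degree_multiset (underlying_jaco_graph n)) v" by simp
  then show ?thesis
    using count_degree_jaco_le_3[of n v] by (intro exI[of _ v]) linarith
qed

section \<open>Curling numbers and multiplicities\<close>

lemma mset_concat_replicate: "mset (concat (replicate k Y)) = repeat_mset k (mset Y)"
  by (induction k) auto

text \<open>
  In \<open>X \<circ> Y\<^sup>k\<close> the first entry of \<open>Y\<close> occurs at least \<open>k\<close> times.
\<close>

lemma curling_number_le:
  assumes "\<And>v. count (mset S) v \<le> c"
  shows "curling_number S \<le> c"
  unfolding curling_number_def
proof (subst Max_le_iff)
  \<comment> \<open>The exponent \<open>0\<close> is always possible, with an arbitrary non-empty block.\<close>
  have "[undefined] \<noteq> [] \<and> S = S @ concat (replicate 0 [undefined])" by simp
  then have "0 \<in> {k. \<exists>X Y. Y \<noteq> [] \<and> S = X @ concat (replicate k Y)}"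
    by (intro CollectI exI)
  then show "{k. \<exists>X Y. Y \<noteq> [] \<and> S = X @ concat (replicate k Y)} \<noteq> {}"
    by (metis empty_iff)
  show "\<forall>k\<in>{k. \<exists>X Y. Y \<noteq> [] \<and> S = X @ concat (replicate k Y)}. k \<le> c"
  proof clarify
    fix k X and Y :: "'a list"
    assume Y: "Y \<noteq> []" and S: "S = X @ concat (replicate k Y)"
    have "1 \<le> count (mset Y) (hd Y)" using Y by (simp add: Suc_le_eq)
    then have "k * 1 \<le> k * count (mset Y) (hd Y)" by (rule mult_le_mono2)
    also have "\<dots> \<le> count (mset S) (hd Y)"
      by (simp add: S mset_concat_replicate)
    also have "\<dots> \<le> c" by (rule assms)
    finally show "k \<le> c" by simp
  qed
qed (rule finite_curling_exponents)

lemma curling_number_append_replicate_ge: "k \<le> curling_number (X @ replicate k v)"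
  unfolding curling_number_def
proof (rule Max_ge[OF finite_curling_exponents], rule CollectI, intro exI conjI)
  have "concat (replicate k [v]) = replicate k v" by (induction k) auto
  then show "X @ replicate k v = X @ concat (replicate k [v])" by simp
qed simp

lemma curling_number_replicate: "curling_number (replicate k v) = k"
proof (rule antisym)
  show "curling_number (replicate k v) \<le> k"
    by (rule curling_number_le) simp
  show "k \<le> curling_number (replicate k v)"
    using curling_number_append_replicate_ge[of k "[]" v] by simp
qed

lemma ex_degree_sequence_ending_in_replicate:
  assumes "c \<le> count (degree_multiset G) v"
  shows "\<exists>X. X @ replicate c v \<in> degree_sequences G"
proof -
  obtain X where "mset X = degree_multiset G - replicate_mset c v"
    using ex_mset by blast
  moreover have "replicate_mset c v \<subseteq># degree_multiset G"
    using assms by (simp add: count_le_replicate_mset_subset_eq)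
  ultimately show ?thesis
    by (intro exI[of _ X]) (simp add: degree_sequences_def permutations_of_multiset_def)
qed

text \<open>
  The upper bound holds for every arrangement of the degrees, as it depends on multiplicities
  only; the arrangement that ends with all copies of \<open>v\<close> attains it.
\<close>

lemma graph_curling_number_eq:
  assumes bound: "\<And>v. count (degree_multiset G) v \<le> c"
    and attained: "count (degree_multiset G) v = c"
  shows "graph_curling_number G = c"
  unfolding graph_curling_number_def
proof (rule antisym)
  obtain X where X: "X @ replicate c v \<in> degree_sequences G"
    using ex_degree_sequence_ending_in_replicate[of c G v] attained by auto
  have fin: "finite (curling_number ` degree_sequences G)"
    by (simp add: degree_sequences_def)
  have le: "curling_number S \<le> c" if "S \<in> degree_sequences G" for S
    using that bound
    by (intro curling_number_le) (simp add: degree_sequences_def permutations_of_multiset_def)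
  show "Max (curling_number ` degree_sequences G) \<le> c"
    using fin X le by (subst Max_le_iff) auto
  have "c \<le> curling_number (X @ replicate c v)"
    by (rule curling_number_append_replicate_ge)
  also have "\<dots> \<le> Max (curling_number ` degree_sequences G)"
    using fin X by (intro Max_ge) auto
  finally show "c \<le> Max (curling_number ` degree_sequences G)" .
qed

lemma subseq_imp_mset_subset_eq: "subseq xs ys \<Longrightarrow> mset xs \<subseteq># mset ys"
proof (induction rule: list_emb.induct)
  case (list_emb_Cons xs ys y)
  then show ?case by (auto simp: subseteq_mset_def le_SucI)
qed simp_all

lemma constant_degree_subsequence_eq_replicate:
  assumes "constant_degree_subsequence G I"
  shows "\<exists>k v. I = replicate k v \<and> k \<le> count (degree_multiset G) v"
proof -
  obtain S v where S: "S \<in> degree_sequences G" "subseq I S" and v: "set I = {v}"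
    using assms unfolding constant_degree_subsequence_def by blast
  have I: "I = replicate (length I) v"
    using v by (intro replicate_length_same[symmetric]) auto
  have "mset I \<subseteq># mset S"
    using S(2) by (auto dest: subseq_imp_mset_subset_eq)
  then have "count (mset I) v \<le> count (mset S) v"
    by (rule mset_subset_eq_count)
  moreover have "count (mset I) v = length I" by (subst I) simp
  ultimately have "length I \<le> count (degree_multiset G) v"
    using S(1) by (simp add: degree_sequences_def permutations_of_multiset_def)
  with I show ?thesis by blast
qed

lemma constant_degree_subsequence_replicate:
  assumes "0 < k" "k \<le> count (degree_multiset G) v"
  shows "constant_degree_subsequence G (replicate k v)"
proof -
  obtain X where "X @ replicate k v \<in> degree_sequences G"
    using ex_degree_sequence_ending_in_replicate[OF assms(2)] by blast
  then show ?thesis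
    unfolding constant_degree_subsequence_def using assms(1) by auto
qed

text \<open>
  A constant subsequence that extends all copies of \<open>v\<close> has the same entry \<open>v\<close>, and there are no
  further copies to add.
\<close>

lemma identity_subsequence_replicate:
  assumes "0 < count (degree_multiset G) v"
  shows "identity_subsequence G (replicate (count (degree_multiset G) v) v)"
    (is "identity_subsequence G ?I")
  unfolding identity_subsequence_def
proof (intro conjI allI impI)
  show "constant_degree_subsequence G ?I"
    using assms by (intro constant_degree_subsequence_replicate) auto
  fix J assume J: "constant_degree_subsequence G J \<and> subseq ?I J"
  then obtain k w where kw: "J = replicate k w" "k \<le> count (degree_multiset G) w"
    using constant_degree_subsequence_eq_replicate by blast
  have sub: "subseq ?I (replicate k w)" using J kw by simp
  have "w = v"
    using set_mset_mono[OF subseq_imp_mset_subset_eq[OF sub]] assms by (auto split: if_splits)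
  moreover have "count (degree_multiset G) v \<le> k"
    using list_emb_length[OF sub] by simp
  ultimately show "J = ?I" using kw by simp
qed

theorem theorem3p3:
  fixes n :: nat
  assumes "n \<ge> 5"
  shows "(\<exists>I. identity_curling_subsequence (underlying_jaco_graph n) I) \<and>
         (\<forall>I. identity_curling_subsequence (underlying_jaco_graph n) I \<longrightarrow> length I = 3)"
proof -
  let ?G = "underlying_jaco_graph n"
  obtain v where v: "count (degree_multiset ?G) v = 3"
    using ex_count_degree_jaco_eq_3[OF assms] by blast
  have cn: "graph_curling_number ?G = 3"
    using count_degree_jaco_le_3 v by (rule graph_curling_number_eq)
  have "identity_curling_subsequence ?G (replicate 3 v)"
    using identity_subsequence_replicate[of ?G v] v
    by (simp add: identity_curling_subsequence_def curling_number_replicate cn)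
  moreover have "length I = 3" if "identity_curling_subsequence ?G I" for I
    using that constant_degree_subsequence_eq_replicate[of ?G I]
    by (auto simp: identity_curling_subsequence_def identity_subsequence_def
        curling_number_replicate cn)
  ultimately show ?thesis by blast
qed

end
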